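(* Let $D$ be the unit disk in the plane, let $A\in(0,\pi)$ and let $n\ge 3$ be an integer. Let $\mathcal P_n(A)$ be the class of simple convex polygons contained in $D$ with at most $n$ vertices and having area less than or equal to $A$. Let $P^*$ be a solution of $$\max_{\Omega\in\mathcal P_n(A)}\operatorname{Per}(\Omega),$$ with no redundant vertices. Then $P^*$ is inscribed in $D$, i.e. every vertex of $P^*$ belongs to $\partial D$.
   Context: $\operatorname{Per}$ denotes the perimeter. $D$ is the closed unit disk. A polygon has no redundant vertices if its vertices are distinct and no three of them are collinear. A "free vertex" of a polygon contained in $D$ is a vertex not lying on $\partial D$; "inscribed" means that there are no free vertices. *)

theory Defs
  imports "HOL-Analysis.Analysis"
begin

text \<open>
  The plane is \<^typ>\<open>complex\<close>, as in the library's Jordan curve theorem. A polygon is given by the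
  list of its vertices in cyclic order; the closing edge from the last vertex to the first is
  implicit.
\<close>

fun polyline :: "complex list \<Rightarrow> real \<Rightarrow> complex" where
  "polyline [] = linepath 0 0"
| "polyline [a] = linepath a a"
| "polyline [a, b] = linepath a b"
| "polyline (a # b # c # vs) = linepath a b +++ polyline (b # c # vs)"

definition boundary_path :: "complex list \<Rightarrow> real \<Rightarrow> complex" where
  "boundary_path vs = polyline (vs @ [hd vs])"

definition polygon_region :: "complex list \<Rightarrow> complex set" where
  "polygon_region vs = path_image (boundary_path vs) \<union> inside (path_image (boundary_path vs))"

definition perimeter :: "complex list \<Rightarrow> real" where
  "perimeter vs = (\<Sum>i<length vs. dist (vs ! i) (vs ! (Suc i mod length vs)))"

definition area :: "complex list \<Rightarrow> real" where
  "area vs = measure lebesgue (polygon_region vs)"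

text \<open>
  Simplicity of the boundary path excludes repeated vertices and degenerate polygons, but a vertex
  in the relative interior of a side, with straight angle, is still allowed.
\<close>

definition simple_convex_polygon :: "complex list \<Rightarrow> bool" where
  "simple_convex_polygon vs \<longleftrightarrow>
     length vs \<ge> 3 \<and> simple_path (boundary_path vs) \<and> convex (polygon_region vs)"

definition no_redundant_vertices :: "complex list \<Rightarrow> bool" where
  "no_redundant_vertices vs \<longleftrightarrow>
     distinct vs \<and>
     (\<forall>x\<in>set vs. \<forall>y\<in>set vs. \<forall>z\<in>set vs. distinct [x, y, z] \<longrightarrow> \<not> collinear {x, y, z})"

definition polygon_class :: "nat \<Rightarrow> real \<Rightarrow> complex list set" where
  "polygon_class n A =
     {vs. simple_convex_polygon vs \<and> polygon_region vs \<subseteq> cball 0 1 \<and> length vs \<le> n \<and> area vs \<le> A}"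

definition inscribed :: "complex list \<Rightarrow> bool" where
  "inscribed vs \<longleftrightarrow> (\<forall>v\<in>set vs. v \<in> frontier (cball 0 1))"

end

theory Submission
  imports Defs
begin

text \<open>
  Suppose that a vertex \<open>v\<close> of the maximizer lies in the open disk, and let \<open>a\<close> and \<open>b\<close> be its
  neighbours. Sliding \<open>v\<close> parallel to the chord \<open>ab\<close> leaves the area unchanged, because the chord splits
  the polygon into the hull of the other vertices and a triangle with base \<open>ab\<close> and constant height
  (\<open>measure_hull_cut_vertex\<close>). The perimeter is a strictly convex function of the displacement
  (\<open>perimeter_strict_midpoint_convex\<close>), so one of two opposite displacements increases it strictly. A small
  displacement keeps \<open>v\<close> in the disk, and it remains to see that the polygon stays simple and convex.

  For this, simplicity and convexity are traded for the condition \<open>edges_support\<close>: every edge line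
  has all other vertices strictly on one side. It consists of finitely many strict inequalities between
  continuous functions of the vertices and is therefore stable. A simple convex polygon without
  redundant vertices satisfies it, by supporting lines at the midpoints of the edges
  (\<open>simple_convex_polygon_imp_edges_support\<close>); conversely it implies that the boundary is a simple
  curve (\<open>edges_support_imp_simple_path\<close>) and, by the Jordan curve theorem, that the region is the convex
  hull of the vertices (\<open>edges_support_imp_region_eq_hull\<close>).
\<close>

section \<open>Signed area in the plane\<close>

text \<open>Twice the signed area of the triangle \<open>a b c\<close>; it is positive iff \<open>c\<close> lies strictly to the left of
  the directed line from \<open>a\<close> to \<open>b\<close>.\<close>

definition orient :: "complex \<Rightarrow> complex \<Rightarrow> complex \<Rightarrow> real" where
  "orient a b c = (Re b - Re a) * (Im c - Im a) - (Im b - Im a) * (Re c - Re a)"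

lemma orient_degenerate [simp]: "orient a a c = 0" "orient a b a = 0" "orient a b b = 0"
  by (simp_all add: orient_def algebra_simps)

lemma orient_rotate: "orient b c a = orient a b c"
  by (simp add: orient_def algebra_simps)

lemma orient_swap: "orient b a c = - orient a b c"
  by (simp add: orient_def algebra_simps)

lemma orient_affine:
  assumes "u + v = 1"
  shows "orient a b (u *\<^sub>R x + v *\<^sub>R y) = u * orient a b x + v * orient a b y"
proof -
  have v: "v = 1 - u" using assms by simp
  show ?thesis by (simp add: orient_def v algebra_simps)
qed

lemma orient_affine3:
  assumes "u + v + w = 1"
  shows "orient a b (u *\<^sub>R x + v *\<^sub>R y + w *\<^sub>R z) =
    u * orient a b x + v * orient a b y + w * orient a b z"
proof -
  have w: "w = 1 - u - v" using assms by simp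
  show ?thesis by (simp add: orient_def w algebra_simps)
qed

text \<open>The next two lemmas give barycentric coordinates with respect to \<open>a b c\<close> in determinant form:
  the coordinate of \<open>x\<close> at a vertex is the signed area of the triangle that \<open>x\<close> spans with the
  opposite side, divided by \<open>orient a b c\<close>.\<close>

lemma barycentric_orient:
  "orient a b c * orient p q x =
     orient b c x * orient p q a + orient c a x * orient p q b + orient a b x * orient p q c"
  by (simp add: orient_def algebra_simps)

lemma barycentric_point:
  assumes "orient a b c \<noteq> 0"
  shows "x = (orient b c x / orient a b c) *\<^sub>R a + (orient c a x / orient a b c) *\<^sub>R b
           + (orient a b x / orient a b c) *\<^sub>R c"
    and "orient b c x / orient a b c + orient c a x / orient a b c + orient a b x / orient a b c = 1"
proof -
  have R: "orient a b c * Re x = orient b c x * Re a + orient c a x * Re b + orient a b x * Re c"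
    and I: "orient a b c * Im x = orient b c x * Im a + orient c a x * Im b + orient a b x * Im c"
    and S: "orient b c x + orient c a x + orient a b x = orient a b c"
    by (simp_all add: orient_def algebra_simps)
  have "orient a b c *\<^sub>R x = orient b c x *\<^sub>R a + orient c a x *\<^sub>R b + orient a b x *\<^sub>R c"
    using R I by (simp add: complex_eq_iff)
  then have "x = (1 / orient a b c) *\<^sub>R (orient b c x *\<^sub>R a + orient c a x *\<^sub>R b + orient a b x *\<^sub>R c)"
    using assms by (metis divide_self_if scaleR_one scaleR_scaleR times_divide_eq_left mult_1)
  then show "x = (orient b c x / orient a b c) *\<^sub>R a + (orient c a x / orient a b c) *\<^sub>R b
           + (orient a b x / orient a b c) *\<^sub>R c"
    by (simp add: scaleR_right_distrib)
  show "orient b c x / orient a b c + orient c a x / orient a b c + orient a b x / orient a b c = 1"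
    using S assms by (metis add_divide_distrib divide_self)
qed

lemma orient_eq_inner: "orient a b x = (\<i> * (b - a)) \<bullet> x - (\<i> * (b - a)) \<bullet> a"
  by (simp add: orient_def inner_complex_def algebra_simps)

lemma convex_half_plane: "convex {x. 0 \<le> s * orient a b x}"
  by (rule convexI) (simp add: orient_affine distrib_left mult.left_commute)

text \<open>A point on the boundary line of a half-plane is not interior to any set inside the half-plane.\<close>

lemma boundary_line_not_interior:
  assumes "a \<noteq> b" "s \<noteq> 0" "K \<subseteq> {x. 0 \<le> s * orient a b x}" "orient a b x = 0"
  shows "x \<notin> interior K"
proof
  define n where "n = s *\<^sub>R (\<i> * (b - a))"
  have n: "n \<noteq> 0" using assms by (simp add: n_def)
  have e: "s * orient a b y = n \<bullet> y - n \<bullet> a" for y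
    by (simp add: n_def orient_eq_inner algebra_simps)
  have K: "K \<subseteq> {x. n \<bullet> x \<ge> n \<bullet> a}" using assms(3) by (auto simp: e)
  assume "x \<in> interior K"
  then have "x \<in> interior {x. n \<bullet> x \<ge> n \<bullet> a}" using interior_mono[OF K] by blast
  then have "n \<bullet> x > n \<bullet> a" using n by simp
  then show False using e[of x] assms(4) by simp
qed

lemma orient_eq_0_imp_collinear:
  assumes "orient a b c = 0"
  shows "collinear {a, b, c}"
proof (cases "a = b")
  case True
  then show ?thesis by simp
next
  case False
  define d where "d = (b - a)"
  have d: "d \<noteq> 0" using False by (simp add: d_def)
  define t where "t = ((c - a) \<bullet> d) / (d \<bullet> d)"
  have dd: "d \<bullet> d \<noteq> 0" using d by simp
  have o: "Re d * Im (c - a) = Im d * Re (c - a)" using assms by (simp add: orient_def d_def)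
  have "(d \<bullet> d) * Re (c - a) = ((c - a) \<bullet> d) * Re d"
       "(d \<bullet> d) * Im (c - a) = ((c - a) \<bullet> d) * Im d"
    using o unfolding inner_complex_def by algebra+
  then have "c - a = t *\<^sub>R d"
    using dd by (simp add: t_def complex_eq_iff field_simps)
  then have "collinear {0, b - a, c - a}" unfolding d_def by (auto simp: collinear_lemma)
  then have "collinear {b, a, c}" using collinear_3[of b a c] by simp
  then show ?thesis by (simp add: insert_commute)
qed

text \<open>The half-plane conditions say that the barycentric coordinates are nonnegative; the factor \<open>s\<close> allows
  both orientations of the triangle.\<close>

lemma mem_triangle:
  assumes "0 < s * orient a b c"
    and "0 \<le> s * orient a b x" "0 \<le> s * orient b c x" "0 \<le> s * orient c a x"
  shows "x \<in> convex hull {a, b, c}"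
proof -
  have nz: "orient a b c \<noteq> 0" using assms by auto
  have pos: "0 \<le> y / orient a b c" if "0 \<le> s * y" for y
  proof -
    have "y / orient a b c = (s * y) / (s * orient a b c)" using assms(1) by auto
    then show ?thesis using that assms(1) by (metis divide_nonneg_pos)
  qed
  show ?thesis unfolding convex_hull_3
    using barycentric_point[OF nz, of x] pos[OF assms(2)] pos[OF assms(3)] pos[OF assms(4)] by blast
qed

text \<open>The area formula for triangles is known in \<open>real ^ 2\<close>; it carries over because the coordinate map to
  the complex plane preserves Lebesgue measure.\<close>

lemma area_triangle_complex: "measure lebesgue (convex hull {a, b, c}) = \<bar>orient a b c\<bar> / 2"
proof -
  define h :: "real ^ 2 \<Rightarrow> complex" where "h v = Complex (v $ 1) (v $ 2)" for v
  define g :: "complex \<Rightarrow> real ^ 2" where "g z = vector [Re z, Im z]" for z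
  have hg [simp]: "h (g z) = z" for z by (simp add: h_def g_def)
  have lin: "linear h"
    by (rule linearI) (simp_all add: h_def complex_eq_iff)
  have hm: "h \<in> borel_measurable borel"
    by (intro borel_measurable_continuous_onI linear_continuous_on linear_conv_bounded_linear[THEN iffD1] lin)
  have inj: "inj h" by (auto simp: inj_def h_def vec_eq_iff forall_2)
  have B2: "(Basis :: (real^2) set) = {axis 1 1, axis 2 1}"
    by (auto simp: Basis_vec_def) (metis (full_types) exhaust_2)
  have ax: "(axis 1 1 :: real^2) \<noteq> axis 2 1" by (simp add: axis_eq_axis)
  have "lborel = distr lborel borel h"
  proof (rule lborel_eqI)
    fix l u :: complex
    assume lu: "\<And>b. b \<in> Basis \<Longrightarrow> l \<bullet> b \<le> u \<bullet> b"
    have lu': "Re l \<le> Re u" "Im l \<le> Im u"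
      using lu[of 1] lu[of "\<i>"] by (simp_all add: Basis_complex_def inner_complex_def)
    have "h -` box l u = box (g l) (g u)"
      by (auto simp: box_def h_def g_def B2 Basis_complex_def inner_axis inner_complex_def)
    then have "emeasure (distr lborel borel h) (box l u) = emeasure lborel (box (g l) (g u))"
      using hm by (simp add: emeasure_distr)
    also have "\<dots> = (\<Prod>b\<in>Basis. (g u - g l) \<bullet> b)"
      using lu' by (intro emeasure_lborel_box)
        (auto simp: B2 g_def inner_axis Basis_complex_def inner_complex_def)
    also have "\<dots> = (\<Prod>b\<in>Basis. (u - l) \<bullet> b)"
      by (simp add: B2 ax g_def inner_axis Basis_complex_def inner_complex_def)
    finally show "emeasure (distr lborel borel h) (box l u) = (\<Prod>b\<in>Basis. (u - l) \<bullet> b)" .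
  qed simp
  moreover have T: "convex hull {a, b, c} \<in> sets borel"
    by (intro borel_compact compact_convex_hull) (simp add: finite_imp_compact)
  ultimately have "measure lborel (convex hull {a, b, c}) = measure lborel (h -` (convex hull {a, b, c}))"
    using hm by (metis measure_distr space_lborel sets_lborel measurable_lborel2 Int_UNIV_right space_borel)
  also have "h -` (convex hull {a, b, c}) = h -` (h ` (convex hull {g a, g b, g c}))"
    by (simp add: convex_hull_linear_image[OF lin])
  also have "\<dots> = convex hull {g a, g b, g c}"
    by (rule inj_vimage_image_eq[OF inj])
  also have "measure lborel (convex hull {g a, g b, g c}) = \<bar>orient a b c\<bar> / 2"
    by (simp add: content_triangle g_def orient_def mult.commute abs_minus_commute)
  finally show ?thesis using T by simp
qed


section \<open>Simple polylines\<close>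

lemma pathstart_polyline [simp]: "vs \<noteq> [] \<Longrightarrow> pathstart (polyline vs) = hd vs"
  by (induction vs rule: polyline.induct) auto

lemma pathfinish_polyline [simp]: "vs \<noteq> [] \<Longrightarrow> pathfinish (polyline vs) = last vs"
  by (induction vs rule: polyline.induct) auto

lemma path_image_polyline:
  "length vs \<ge> 2 \<Longrightarrow>
     path_image (polyline vs) = (\<Union>i<length vs - 1. closed_segment (vs ! i) (vs ! Suc i))"
proof (induction vs rule: polyline.induct)
  case (4 a b c vs)
  have "path_image (polyline (a # b # c # vs)) = closed_segment a b \<union> path_image (polyline (b # c # vs))"
    by (simp add: path_image_join)
  also have "\<dots> = (\<Union>i<Suc (length (b # c # vs) - 1).
      closed_segment ((a # b # c # vs) ! i) ((a # b # c # vs) ! Suc i))"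
    unfolding lessThan_Suc_eq_insert_0 using 4 by simp
  finally show ?case by simp
qed auto

text \<open>The hypothesis on intersections leaves out the edge that closes a polygon: a closed polygon is an arc of
  this kind joined with one further segment.\<close>

lemma arc_polyline:
  assumes "length vs \<ge> 2"
    and "\<And>i. i < length vs - 1 \<Longrightarrow> vs ! i \<noteq> vs ! Suc i"
    and "\<And>i j x. i < j \<Longrightarrow> j < length vs - 1 \<Longrightarrow> x \<in> closed_segment (vs ! i) (vs ! Suc i) \<Longrightarrow>
           x \<in> closed_segment (vs ! j) (vs ! Suc j) \<Longrightarrow> j = Suc i \<and> x = vs ! j"
  shows "arc (polyline vs)"
  using assms
proof (induction vs rule: polyline.induct)
  case (3 a b)
  from 3(2)[of 0] show ?case by (simp add: arc_linepath)
next
  case (4 a b c vs)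
  let ?ws = "b # c # vs"
  have "arc (polyline ?ws)"
  proof (rule "4.IH")
    show "?ws ! i \<noteq> ?ws ! Suc i" if "i < length ?ws - 1" for i
      using 4(3)[of "Suc i"] that by simp
    show "j = Suc i \<and> x = ?ws ! j" if "i < j" "j < length ?ws - 1"
      "x \<in> closed_segment (?ws ! i) (?ws ! Suc i)" "x \<in> closed_segment (?ws ! j) (?ws ! Suc j)" for i j x
      using 4(4)[of "Suc i" "Suc j" x] that by simp
  qed simp
  moreover have "arc (linepath a b)" using 4(3)[of 0] by (simp add: arc_linepath)
  moreover have "x = b" if x: "x \<in> closed_segment a b" "x \<in> path_image (polyline ?ws)" for x
  proof -
    obtain j where j: "j < length ?ws - 1" "x \<in> closed_segment (?ws ! j) (?ws ! Suc j)"
      using x(2) by (subst (asm) path_image_polyline) auto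
    then show ?thesis using 4(4)[of 0 "Suc j" x] x(1) by simp
  qed
  ultimately show ?case by (auto intro!: arc_join)
qed auto

definition edge :: "complex list \<Rightarrow> nat \<Rightarrow> complex set" where
  "edge vs i = closed_segment (vs ! i) (vs ! (Suc i mod length vs))"

lemma nth_closed_list:
  assumes "i < length vs"
  shows "(vs @ [hd vs]) ! Suc i = vs ! (Suc i mod length vs)"
proof (cases "Suc i = length vs")
  case True
  moreover have "vs \<noteq> []" using assms by auto
  ultimately show ?thesis by (simp add: hd_conv_nth nth_append)
next
  case False
  then show ?thesis using assms by (simp add: nth_append)
qed

lemma path_image_boundary_path:
  assumes "vs \<noteq> []"
  shows "path_image (boundary_path vs) = (\<Union>i<length vs. edge vs i)"
proof -
  have "closed_segment ((vs @ [hd vs]) ! i) ((vs @ [hd vs]) ! Suc i) = edge vs i" if "i < length vs" for i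
    using that unfolding edge_def nth_closed_list[OF that] by (simp add: nth_append)
  moreover have "length (vs @ [hd vs]) \<ge> 2" using assms by (cases vs) auto
  ultimately show ?thesis by (simp add: boundary_path_def path_image_polyline)
qed

lemma closed_boundary_path:
  assumes "vs \<noteq> []"
  shows "pathfinish (boundary_path vs) = pathstart (boundary_path vs)"
  using assms by (simp add: boundary_path_def)

section \<open>Polygons all of whose edges support the vertex set\<close>

text \<open>Strict convex position in cyclic order, expressed by finitely many strict inequalities so that it
  survives small perturbations of the vertices. The sign of \<open>s\<close> is the orientation, as the list may run
  either way around.\<close>

definition edges_support :: "real \<Rightarrow> complex list \<Rightarrow> bool" where
  "edges_support s vs \<longleftrightarrow> length vs \<ge> 3 \<and>
     (\<forall>i<length vs. \<forall>k<length vs. k \<noteq> i \<longrightarrow> k \<noteq> Suc i mod length vs \<longrightarrow>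
        0 < s * orient (vs ! i) (vs ! (Suc i mod length vs)) (vs ! k))"

lemma edges_supportD:
  assumes "edges_support s vs" "i < length vs" "k < length vs" "k \<noteq> i" "k \<noteq> Suc i mod length vs"
  shows "0 < s * orient (vs ! i) (vs ! (Suc i mod length vs)) (vs ! k)"
  using assms unfolding edges_support_def by blast

lemma edges_support_weak:
  assumes "edges_support s vs" "i < length vs" "k < length vs"
  shows "0 \<le> s * orient (vs ! i) (vs ! (Suc i mod length vs)) (vs ! k)"
  using edges_supportD[OF assms] by (cases "k = i \<or> k = Suc i mod length vs") (auto intro: less_imp_le)

lemma Suc_mod_cases:
  assumes "i < (n::nat)"
  obtains "Suc i < n" "Suc i mod n = Suc i" | "Suc i = n" "Suc i mod n = 0"
  using assms by (cases "Suc i = n") auto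

lemma cyclic_neighbours:
  assumes "n \<ge> (3::nat)" "p < n" "Suc p mod n = i" "q = Suc i mod n"
  shows "i < n" "q < n" "q \<noteq> p" "q \<noteq> i" "p \<noteq> i"
proof -
  show i: "i < n" and "q < n" using assms by (auto intro!: mod_less_divisor)
  show "q \<noteq> p" "q \<noteq> i" "p \<noteq> i"
    unfolding assms(4) using assms(1,3)
    by (cases rule: Suc_mod_cases[OF assms(2)]; cases rule: Suc_mod_cases[OF i]; auto)+
qed

lemma edges_support_edge_nontrivial:
  assumes "edges_support s vs" "i < length vs"
  shows "vs ! i \<noteq> vs ! (Suc i mod length vs)" and "s \<noteq> 0"
proof -
  have l: "length vs \<ge> 3" using assms(1) by (simp add: edges_support_def)
  have "card {i, Suc i mod length vs} < card {..<length vs}"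
    using l card_insert_le_m1[of 2 "{Suc i mod length vs}" i] by simp
  then obtain k where "k < length vs" "k \<noteq> i" "k \<noteq> Suc i mod length vs"
    by (metis card_mono finite.intros insert_iff lessThan_iff not_le subsetI)
  from edges_supportD[OF assms this]
  show "vs ! i \<noteq> vs ! (Suc i mod length vs)" and "s \<noteq> 0" by auto
qed

text \<open>Along one edge the signed distance to another edge line is affine and nonnegative, so it can vanish
  only where both edges share a vertex.\<close>

lemma edges_support_edges_meet:
  assumes "edges_support s vs" "i < length vs" "j < length vs" "i \<noteq> j" "x \<in> edge vs i" "x \<in> edge vs j"
  shows "j = Suc i mod length vs \<and> x = vs ! j \<or> i = Suc j mod length vs \<and> x = vs ! i"
proof -
  let ?n = "length vs"
  let ?o = "\<lambda>x. s * orient (vs ! i) (vs ! (Suc i mod ?n)) x"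
  have n: "?n \<ge> 3" using assms by (simp add: edges_support_def)
  have j': "Suc j mod ?n < ?n" using n by (metis mod_less_divisor gr0I not_numeral_le_zero)
  have ne: "Suc i mod ?n \<noteq> Suc j mod ?n"
    using assms(4)
    by (cases rule: Suc_mod_cases[OF assms(2)]; cases rule: Suc_mod_cases[OF assms(3)]) auto
  obtain u where u: "0 \<le> u" "u \<le> 1" "x = (1 - u) *\<^sub>R vs ! i + u *\<^sub>R vs ! (Suc i mod ?n)"
    using assms(5) by (auto simp: edge_def in_segment)
  have x0: "?o x = 0" by (simp add: u(3) orient_affine)
  obtain w where w: "0 \<le> w" "w \<le> 1" "x = (1 - w) *\<^sub>R vs ! j + w *\<^sub>R vs ! (Suc j mod ?n)"
    using assms(6) by (auto simp: edge_def in_segment)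
  have sum0: "(1 - w) * ?o (vs ! j) + w * ?o (vs ! (Suc j mod ?n)) = 0"
    using x0 orient_affine[of "1 - w" w] by (simp add: w(3) distrib_left mult.left_commute)
  have nn: "0 \<le> (1 - w) * ?o (vs ! j)" "0 \<le> w * ?o (vs ! (Suc j mod ?n))"
    using w edges_support_weak[OF assms(1,2) assms(3)] edges_support_weak[OF assms(1,2) j'] by simp_all
  then have z: "w = 1 \<or> ?o (vs ! j) = 0" "w = 0 \<or> ?o (vs ! (Suc j mod ?n)) = 0"
    using sum0 by (auto simp: add_nonneg_eq_0_iff)
  show ?thesis
  proof (cases "j = Suc i mod ?n")
    case True
    have "Suc j mod ?n \<noteq> i" using True n assms(2)
      by (cases rule: Suc_mod_cases[OF assms(2)]; cases rule: Suc_mod_cases[OF assms(3)]) auto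
    then have "w = 0" using z(2) edges_supportD[OF assms(1,2) j'] ne by force
    then show ?thesis using True w(3) by simp
  next
    case False
    then have w1: "w = 1" using z(1) edges_supportD[OF assms(1,2,3)] assms(4) by force
    then have "i = Suc j mod ?n" using z(2) edges_supportD[OF assms(1,2) j'] ne by force
    then show ?thesis using w1 w(3) by simp
  qed
qed

text \<open>The first edge is split off, since a loop is simple when it consists of two arcs that meet only at their
  common endpoints.\<close>

lemma edges_support_imp_simple_path:
  assumes "edges_support s vs"
  shows "simple_path (boundary_path vs)"
proof -
  let ?n = "length vs"
  have n: "?n \<ge> 3" using assms by (simp add: edges_support_def)
  then obtain a b c vs' where vs: "vs = a # b # c # vs'"
    by (metis Suc_le_length_iff numeral_3_eq_3)
  let ?ws = "tl vs @ [hd vs]"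
  have nth: "?ws ! i = vs ! (Suc i mod ?n)" if "i < ?n" for i
    using nth_closed_list[OF that] vs by simp
  have seg: "closed_segment (?ws ! i) (?ws ! Suc i) = edge vs (Suc i)" if "i < ?n - 1" for i
  proof -
    have "Suc i < ?n" using that by linarith
    then show ?thesis by (simp only: nth edge_def Suc_lessD mod_less)
  qed
  have len: "length ?ws = ?n" by (simp add: vs)
  have arc: "arc (polyline ?ws)"
  proof (rule arc_polyline)
    show "length ?ws \<ge> 2" using n len by linarith
    show "?ws ! i \<noteq> ?ws ! Suc i" if "i < length ?ws - 1" for i
    proof -
      have "Suc i < ?n" using that len by linarith
      then have "?ws ! i = vs ! Suc i" "?ws ! Suc i = vs ! (Suc (Suc i) mod ?n)"
        using nth[of i] nth[of "Suc i"] by simp_all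
      then show ?thesis using edges_support_edge_nontrivial(1)[OF assms, of "Suc i"] \<open>Suc i < ?n\<close> by metis
    qed
    show "j = Suc i \<and> x = ?ws ! j" if "i < j" "j < length ?ws - 1"
      "x \<in> closed_segment (?ws ! i) (?ws ! Suc i)" "x \<in> closed_segment (?ws ! j) (?ws ! Suc j)" for i j x
    proof -
      have ij: "Suc i < ?n" "Suc j < ?n" "i < ?n - 1" "j < ?n - 1" "j < ?n" using that len by linarith+
      have "Suc j = Suc (Suc i) mod ?n \<and> x = vs ! Suc j \<or> Suc i = Suc (Suc j) mod ?n \<and> x = vs ! Suc i"
        using that ij by (intro edges_support_edges_meet[OF assms]) (simp_all add: seg)
      moreover have "Suc i \<noteq> Suc (Suc j) mod ?n"
        using \<open>i < j\<close> ij by (cases rule: Suc_mod_cases[OF ij(2)]) auto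
      moreover have "Suc (Suc i) mod ?n = Suc (Suc i)" using that ij by simp
      ultimately show ?thesis using nth[OF ij(5)] ij by simp
    qed
  qed
  have "simple_path (linepath a b +++ polyline ?ws)"
  proof (rule simple_path_join_loop)
    show "arc (linepath a b)" using edges_support_edge_nontrivial(1)[OF assms, of 0] by (simp add: vs arc_linepath)
    show "path_image (linepath a b) \<inter> path_image (polyline ?ws) \<subseteq> {pathstart (linepath a b), pathstart (polyline ?ws)}"
    proof
      fix x assume x: "x \<in> path_image (linepath a b) \<inter> path_image (polyline ?ws)"
      have "length ?ws \<ge> 2" using n len by linarith
      then obtain i where i: "i < ?n - 1" "x \<in> edge vs (Suc i)"
        using x seg unfolding path_image_polyline[OF \<open>length ?ws \<ge> 2\<close>] len by blast
      have "x \<in> edge vs 0" using x by (simp add: edge_def vs)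
      then have "Suc i = Suc 0 mod ?n \<and> x = vs ! Suc i \<or> 0 = Suc (Suc i) mod ?n \<and> x = vs ! 0"
        using i n by (intro edges_support_edges_meet[OF assms]) auto
      then show "x \<in> {pathstart (linepath a b), pathstart (polyline ?ws)}" by (auto simp: vs)
    qed
  qed (use arc in \<open>simp_all add: vs\<close>)
  then show ?thesis by (simp add: boundary_path_def vs)
qed

section \<open>The region bounded by a polygon\<close>

text \<open>The boundary lies on the edge lines, hence misses the interior of the hull, which is therefore
  connected in the complement of the boundary; the complement of the hull is outside. So the inside
  is exactly the interior of the hull.\<close>

lemma edges_support_imp_region_eq_hull:
  assumes "edges_support s vs"
  shows "polygon_region vs = convex hull (set vs)"
proof -
  let ?n = "length vs"
  define J where "J = path_image (boundary_path vs)"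
  define K where "K = convex hull (set vs)"
  have n: "?n \<ge> 3" using assms by (simp add: edges_support_def)
  then have ne: "vs \<noteq> []" by auto
  have J: "J = (\<Union>i<?n. edge vs i)" unfolding J_def by (rule path_image_boundary_path[OF ne])
  have mem: "Suc i mod ?n < ?n" for i using ne by simp
  have JK: "J \<subseteq> K"
    unfolding J edge_def K_def using mem
    by (intro UN_least closed_segment_subset hull_inc nth_mem convex_convex_hull) auto
  have int: "x \<notin> interior K" if x: "x \<in> J" for x
  proof -
    obtain i where i: "i < ?n" "x \<in> edge vs i" using x unfolding J by blast
    have "K \<subseteq> {x. 0 \<le> s * orient (vs ! i) (vs ! (Suc i mod ?n)) x}"
      unfolding K_def using edges_support_weak[OF assms i(1)]
      by (intro hull_minimal convex_half_plane) (auto simp: in_set_conv_nth)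
    moreover have "orient (vs ! i) (vs ! (Suc i mod ?n)) x = 0"
      using i(2) by (auto simp: edge_def in_segment orient_affine)
    ultimately show ?thesis
      using boundary_line_not_interior edges_support_edge_nontrivial[OF assms i(1)] by blast
  qed
  note jordan = Jordan_inside_outside[OF edges_support_imp_simple_path[OF assms] closed_boundary_path[OF ne],
      folded J_def]
  have "- K \<subseteq> outside J"
    using JK by (intro outside_subset_convex) (simp_all add: K_def)
  then have "inside J \<subseteq> K" using jordan by blast
  then have 1: "inside J \<subseteq> interior K" using jordan by (intro interior_maximal) auto
  have cover: "interior K \<subseteq> inside J \<union> outside J" using jordan int by blast
  have "connected (interior K)" by (simp add: K_def convex_connected convex_interior)
  then have "inside J \<inter> interior K = {} \<or> outside J \<inter> interior K = {}"
    by (rule connectedD) (use jordan cover in auto)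
  moreover have "inside J \<inter> interior K \<noteq> {}" using 1 jordan by auto
  ultimately have in_eq: "inside J = interior K" using 1 cover by blast
  then have "K = closure (interior K)"
    using jordan convex_closure_interior[of K]
    by (simp add: K_def closure_closed compact_imp_closed compact_convex_hull finite_imp_compact)
  also have "\<dots> = inside J \<union> J"
    unfolding in_eq[symmetric] closure_Un_frontier using jordan by simp
  finally show ?thesis by (simp add: polygon_region_def J_def[symmetric] K_def Un_commute)
qed

text \<open>The midpoint of an edge lies on the frontier of the convex region. A supporting line there contains
  the whole edge, because the midpoint is not one of its ends, and hence is the edge line.\<close>

lemma simple_convex_polygon_same_side:
  assumes P: "simple_convex_polygon P" "no_redundant_vertices P"
    and i: "i < length P" and k: "k < length P" "k \<noteq> i" "k \<noteq> Suc i mod length P"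
    and l: "l < length P" "l \<noteq> i" "l \<noteq> Suc i mod length P"
  shows "0 < orient (P ! i) (P ! (Suc i mod length P)) (P ! k)
             * orient (P ! i) (P ! (Suc i mod length P)) (P ! l)"
proof -
  let ?n = "length P"
  define j where "j = Suc i mod ?n"
  define J where "J = path_image (boundary_path P)"
  define R where "R = polygon_region P"
  define m where "m = midpoint (P ! i) (P ! j)"
  have n: "?n \<ge> 3" and simple: "simple_path (boundary_path P)" and conv: "convex R"
    using P by (simp_all add: simple_convex_polygon_def R_def)
  have ne: "P \<noteq> []" using n by auto
  have j: "j < ?n" "j \<noteq> i"
    unfolding j_def using n by (cases rule: Suc_mod_cases[OF i]; auto)+
  have R: "R = J \<union> inside J" by (simp add: R_def polygon_region_def J_def)
  note jordan = Jordan_inside_outside[OF simple closed_boundary_path[OF ne], folded J_def]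
  have "frontier R = J" using jordan unfolding R union_with_inside frontier_complement by simp
  have JU: "J = (\<Union>i<?n. edge P i)" unfolding J_def by (rule path_image_boundary_path[OF ne])
  have vR: "P ! k \<in> R" if "k < ?n" for k
    using that unfolding R JU edge_def by blast
  have mJ: "m \<in> J" using i midpoint_in_closed_segment unfolding JU edge_def m_def j_def by blast
  have "inside J \<subseteq> interior R" using jordan by (intro interior_maximal) (auto simp: R)
  then have "rel_interior R = interior R" using jordan by (intro rel_interior_nonempty_interior) auto
  then have "m \<notin> rel_interior R" using mJ \<open>frontier R = J\<close> by (auto simp: frontier_def)
  then obtain a where a: "a \<noteq> 0" "\<And>y. y \<in> R \<Longrightarrow> a \<bullet> m \<le> a \<bullet> y"
    using supporting_hyperplane_rel_boundary[OF conv] mJ R by blast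
  \<comment> \<open>Both ends of the edge lie on the nonnegative side and their average on the line.\<close>
  have "a \<bullet> m = (a \<bullet> (P ! i) + a \<bullet> (P ! j)) / 2"
    by (simp add: m_def midpoint_def inner_add_right field_simps)
  then have ai: "a \<bullet> (P ! i) = a \<bullet> m" "a \<bullet> (P ! j - P ! i) = 0"
    using a(2)[OF vR[OF i]] a(2)[OF vR[OF j(1)]] by (simp_all add: inner_diff_right)
  \<comment> \<open>In the plane, the distance to the line with normal \<open>a\<close> is then proportional to \<open>orient\<close>.\<close>
  define d where "d = P ! j - P ! i"
  define c where "c = Re d * Im a - Im d * Re a"
  have "orient (P ! i) (P ! j) x * (a \<bullet> a) = c * (a \<bullet> (x - P ! i))" for x
  proof -
    have "Re a * Re d + Im a * Im d = 0" using ai(2) by (simp add: d_def inner_complex_def)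
    then have "(Re d * Im y - Im d * Re y) * (Re a * Re a + Im a * Im a) =
      (Re d * Im a - Im d * Re a) * (Re a * Re y + Im a * Im y)" for y by algebra
    from this[of "x - P ! i"] show ?thesis
      by (simp add: orient_def d_def c_def inner_complex_def)
  qed
  then have o: "orient (P ! i) (P ! j) x = (c / (a \<bullet> a)) * (a \<bullet> (x - P ! i))" for x
    using a(1) by (simp add: field_simps)
  have nonneg: "0 \<le> a \<bullet> (P ! k - P ! i)" if "k < ?n" for k
    using a(2)[OF vR[OF that]] ai by (simp add: inner_diff_right)
  have "orient (P ! i) (P ! j) (P ! k) * orient (P ! i) (P ! j) (P ! l) =
      (c / (a \<bullet> a))\<^sup>2 * ((a \<bullet> (P ! k - P ! i)) * (a \<bullet> (P ! l - P ! i)))"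
    unfolding o by (simp add: power2_eq_square)
  then have "0 \<le> orient (P ! i) (P ! j) (P ! k) * orient (P ! i) (P ! j) (P ! l)"
    using nonneg[OF k(1)] nonneg[OF l(1)] by simp
  moreover have "orient (P ! i) (P ! j) (P ! k) \<noteq> 0" if "k < ?n" "k \<noteq> i" "k \<noteq> j" for k
  proof
    assume "orient (P ! i) (P ! j) (P ! k) = 0"
    then have "collinear {P ! i, P ! j, P ! k}" by (rule orient_eq_0_imp_collinear)
    moreover have "distinct [P ! i, P ! j, P ! k]"
      using P(2) that i j by (simp add: no_redundant_vertices_def nth_eq_iff_index_eq)
    ultimately show False
      using P(2) that i j unfolding no_redundant_vertices_def by (meson nth_mem)
  qed
  ultimately show ?thesis using k l unfolding j_def[symmetric] by (simp add: less_le)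
qed

text \<open>Consecutive edges share their sign because \<open>orient\<close> is invariant under cyclic rotation: the triangle
  of three consecutive vertices tests both edges.\<close>

lemma simple_convex_polygon_imp_edges_support:
  assumes P: "simple_convex_polygon P" "no_redundant_vertices P"
  obtains s where "edges_support s P"
proof -
  let ?n = "length P"
  define v where "v k = P ! (k mod ?n)" for k
  define t where "t i = orient (v i) (v (Suc i)) (v (Suc (Suc i)))" for i
  have n: "?n \<ge> 3" using P by (simp add: simple_convex_polygon_def)
  have Smod: "Suc i mod ?n \<noteq> i mod ?n" "Suc (Suc i) mod ?n \<noteq> i mod ?n" for i
  proof -
    have "i mod ?n < ?n" using n by (intro mod_less_divisor) linarith
    then have "Suc (i mod ?n) mod ?n \<noteq> i mod ?n" "Suc (Suc (i mod ?n)) mod ?n \<noteq> i mod ?n"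
      using n by (auto simp: mod_Suc)
    then show "Suc i mod ?n \<noteq> i mod ?n" "Suc (Suc i) mod ?n \<noteq> i mod ?n" by (simp_all add: mod_Suc_eq mod_Suc_Suc_eq)
  qed
  have side: "0 < orient (v i) (v (Suc i)) (v k) * orient (v i) (v (Suc i)) (v l)"
    if "k mod ?n \<noteq> i mod ?n" "k mod ?n \<noteq> Suc i mod ?n" "l mod ?n \<noteq> i mod ?n" "l mod ?n \<noteq> Suc i mod ?n" for i k l
  proof -
    have "0 < ?n" using n by linarith
    then show ?thesis
      using simple_convex_polygon_same_side[OF P, of "i mod ?n" "k mod ?n" "l mod ?n"] that
      by (simp add: v_def mod_Suc_eq)
  qed
  have tt: "0 < t i * t (Suc i)" for i
  proof -
    have "0 < orient (v (Suc i)) (v (Suc (Suc i))) (v i) * t (Suc i)"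
      unfolding t_def using Smod[of i] Smod[of "Suc i"] Smod[of "Suc (Suc i)"] by (intro side) auto
    then show ?thesis by (simp add: t_def orient_rotate)
  qed
  have t0: "0 < t 0 * t i" for i
  proof (induction i)
    case 0
    then show ?case using tt[of 0] by (auto simp: zero_less_mult_iff)
  next
    case (Suc i)
    then show ?case using tt[of i] by (auto simp: zero_less_mult_iff)
  qed
  have "edges_support (t 0) P" unfolding edges_support_def
  proof (intro conjI allI impI)
    fix i k assume *: "i < ?n" "k < ?n" "k \<noteq> i" "k \<noteq> Suc i mod ?n"
    have "0 < t i * orient (v i) (v (Suc i)) (v k)"
      unfolding t_def using * Smod[of i] Smod[of "Suc i"] by (intro side) auto
    then have "0 < t 0 * orient (v i) (v (Suc i)) (v k)"
      using t0[of i] by (auto simp: zero_less_mult_iff)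
    then show "0 < t 0 * orient (P ! i) (P ! (Suc i mod ?n)) (P ! k)"
      using * by (simp add: v_def)
  qed (rule n)
  then show ?thesis by (rule that)
qed

section \<open>Cutting off a vertex\<close>

text \<open>If \<open>vs ! k\<close> were on the wrong side of the chord between the neighbours of \<open>vs ! i\<close>, it would lie in the
  triangle that the chord cuts off, against the supporting edge line that starts at \<open>vs ! k\<close>.\<close>

lemma edges_support_chord:
  assumes E: "edges_support s vs" and p: "p < length vs" "Suc p mod length vs = i"
    and q: "q = Suc i mod length vs" and k: "k < length vs" "k \<noteq> p" "k \<noteq> i" "k \<noteq> q"
  shows "0 < s * orient (vs ! p) (vs ! q) (vs ! k)"
proof (rule ccontr)
  let ?n = "length vs"
  define k' where "k' = Suc k mod ?n"
  define d where "d x = s * orient (vs ! k) (vs ! k') x" for x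
  have n: "?n \<ge> 3" using E by (simp add: edges_support_def)
  note i = cyclic_neighbours(1)[OF n p q] and ql = cyclic_neighbours(2)[OF n p q]
  have Suc_mod_inj: "j = l" if "Suc j mod ?n = Suc l mod ?n" "j < ?n" "l < ?n" for j l
    using that(1) by (cases rule: Suc_mod_cases[OF that(2)]; cases rule: Suc_mod_cases[OF that(3)]) auto
  have k': "k' \<noteq> i" "k' \<noteq> q"
    using Suc_mod_inj[of k p] Suc_mod_inj[of k i] k p i by (auto simp: k'_def q)
  assume "\<not> ?thesis"
  then have neg: "0 \<le> s * orient (vs ! q) (vs ! p) (vs ! k)"
    by (simp add: orient_swap[of "vs ! q"] not_less)
  have 1: "0 < s * orient (vs ! p) (vs ! i) (vs ! k)"
    using edges_supportD[OF E p(1) k(1)] k p by simp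
  have 2: "0 < s * orient (vs ! i) (vs ! q) (vs ! k)"
    using edges_supportD[OF E i k(1)] k q by simp
  have dp: "0 \<le> d (vs ! p)" unfolding d_def k'_def by (rule edges_support_weak[OF E k(1) p(1)])
  have di: "0 \<le> d (vs ! i)" unfolding d_def k'_def by (rule edges_support_weak[OF E k(1) i])
  have dq: "0 < d (vs ! q)" unfolding d_def k'_def
    using edges_supportD[OF E k(1) ql] k k' by (simp add: k'_def)
  let ?o = orient
  have "0 = s * (s * (?o (vs ! p) (vs ! i) (vs ! q) * ?o (vs ! k) (vs ! k') (vs ! k)))" by simp
  also have "\<dots> = (s * ?o (vs ! i) (vs ! q) (vs ! k)) * d (vs ! p) + (s * ?o (vs ! q) (vs ! p) (vs ! k)) * d (vs ! i)
    + (s * ?o (vs ! p) (vs ! i) (vs ! k)) * d (vs ! q)"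
    using arg_cong[OF barycentric_orient[of "vs ! p" "vs ! i" "vs ! q" "vs ! k" "vs ! k'" "vs ! k"],
        of "\<lambda>y. s * (s * y)"]
    by (simp add: d_def distrib_left mult_ac)
  finally have "(s * ?o (vs ! i) (vs ! q) (vs ! k)) * d (vs ! p) + (s * ?o (vs ! q) (vs ! p) (vs ! k)) * d (vs ! i)
    + (s * ?o (vs ! p) (vs ! i) (vs ! k)) * d (vs ! q) = 0" by simp
  moreover have "0 \<le> (s * ?o (vs ! i) (vs ! q) (vs ! k)) * d (vs ! p)" using 2 dp by simp
  moreover have "0 \<le> (s * ?o (vs ! q) (vs ! p) (vs ! k)) * d (vs ! i)" using neg di by simp
  moreover have "0 < (s * ?o (vs ! p) (vs ! i) (vs ! k)) * d (vs ! q)" using 1 dq by simp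
  ultimately show False by linarith
qed

text \<open>The chord between the neighbours of a vertex splits the hull into the hull of the remaining vertices
  and a triangle. The first summand does not see the vertex and the second is unchanged when the
  vertex moves parallel to the chord.\<close>

lemma measure_hull_cut_vertex:
  assumes E: "edges_support s vs" and p: "p < length vs" "Suc p mod length vs = i"
    and q: "q = Suc i mod length vs"
  shows "measure lebesgue (convex hull (set vs)) =
    measure lebesgue (convex hull ((!) vs ` ({..<length vs} - {i}))) + \<bar>orient (vs ! p) (vs ! i) (vs ! q)\<bar> / 2"
proof -
  let ?n = "length vs"
  define S where "S = (!) vs ` ({..<?n} - {i})"
  define a b v where "a = vs ! p" and "b = vs ! q" and "v = vs ! i"
  define g where "g x = s * orient a b x" for x
  have n: "?n \<ge> 3" using E by (simp add: edges_support_def)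
  note i = cyclic_neighbours(1)[OF n p q] and ql = cyclic_neighbours(2)[OF n p q]
  note pq = cyclic_neighbours(3-5)[OF n p q]
  have o: "0 < s * orient a v b"
    using edges_supportD[OF E p(1) ql] pq p(2) by (simp add: a_def b_def v_def)
  have gaff: "g (u *\<^sub>R x + w *\<^sub>R y) = u * g x + w * g y" if "u + w = 1" for u w x y
    using that by (simp add: g_def orient_affine distrib_left mult.left_commute)
  have gv: "g v < 0"
    using o orient_swap[of a b v] orient_rotate[of a v b] by (simp add: g_def)
  have gS: "0 \<le> g x" if "x \<in> S" for x
  proof -
    obtain k where x: "x = vs ! k" and "k \<in> {..<?n} - {i}"
      using \<open>x \<in> S\<close> unfolding S_def by (rule imageE)
    then have k: "k < ?n" "k \<noteq> i" by auto
    show ?thesis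
    proof (cases "k = p \<or> k = q")
      case True
      then show ?thesis unfolding g_def a_def b_def x by auto
    next
      case False
      then show ?thesis
        using edges_support_chord[OF E p q k(1) _ k(2)] unfolding g_def a_def b_def x by simp
    qed
  qed
  have hS: "convex hull S \<subseteq> {x. 0 \<le> g x}"
    unfolding g_def by (intro hull_minimal convex_half_plane) (use gS[unfolded g_def] in auto)
  have hT: "convex hull {a, v, b} \<subseteq> {x. 0 \<le> s * orient b a x}"
    by (intro hull_minimal convex_half_plane) (use gv in \<open>auto simp: g_def orient_swap[of b a]\<close>)
  have set: "set vs = insert v S"
    using i by (auto simp: S_def v_def set_conv_nth image_iff)
  have abS: "a \<in> S" "b \<in> S" using p(1) ql pq by (auto simp: S_def a_def b_def)
  have edge_side: "convex hull (set vs) \<subseteq> {x. 0 \<le> s * orient (vs ! j) (vs ! (Suc j mod ?n)) x}" if "j < ?n" for j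
    using edges_support_weak[OF E that] by (intro hull_minimal convex_half_plane) (auto simp: in_set_conv_nth)
  have inT: "x \<in> convex hull {a, v, b}" if "x \<in> convex hull (set vs)" "g x \<le> 0" for x
  proof (rule mem_triangle[OF o])
    show "0 \<le> s * orient a v x" "0 \<le> s * orient v b x"
      using edge_side[OF p(1)] edge_side[OF i] that(1) unfolding p(2) q[symmetric] a_def v_def b_def by auto
    show "0 \<le> s * orient b a x" using that(2) by (simp add: g_def orient_swap[of b a])
  qed
  have hull_insert: "\<exists>u y. 0 \<le> u \<and> u \<le> 1 \<and> y \<in> convex hull S \<and> x = u *\<^sub>R v + (1 - u) *\<^sub>R y"
    if x: "x \<in> convex hull (set vs)" for x
  proof -
    obtain u u' y where "0 \<le> u" "0 \<le> u'" "u + u' = 1" "y \<in> convex hull S" "x = u *\<^sub>R v + u' *\<^sub>R y"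
      using x abS unfolding set by (subst (asm) convex_hull_insert) blast+
    moreover from this have "u' = 1 - u" by linarith
    ultimately show ?thesis by auto
  qed
  have hull: "convex hull (set vs) = convex hull S \<union> convex hull {a, v, b}"
  proof
    show "convex hull S \<union> convex hull {a, v, b} \<subseteq> convex hull (set vs)"
      using abS unfolding set by (intro Un_least hull_mono) auto
    show "convex hull (set vs) \<subseteq> convex hull S \<union> convex hull {a, v, b}"
    proof
      fix x assume x: "x \<in> convex hull (set vs)"
      show "x \<in> convex hull S \<union> convex hull {a, v, b}"
      proof (cases "g x \<le> 0")
        case True
        then show ?thesis using inT x by simp
      next
        case False
        \<comment> \<open>The segment from \<open>v\<close> to \<open>x\<close> crosses the chord at a point \<open>z\<close>, and \<open>x\<close> lies between \<open>z\<close> and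
          the hull of the other vertices.\<close>
        from x obtain u y where u: "0 \<le> u" "u \<le> 1" "y \<in> convex hull S" "x = u *\<^sub>R v + (1 - u) *\<^sub>R y"
          using hull_insert by blast
        have gx: "g x = u * g v + (1 - u) * g y" by (simp add: u(4) gaff)
        have gy: "0 \<le> g y" using u(3) hS by auto
        define w where "w = g y / (g y - g v)"
        have w: "0 \<le> w" "w \<le> 1" and gz0: "w * g v + (1 - w) * g y = 0"
          using gv gy by (simp_all add: w_def field_simps)
        have "u < w"
        proof -
          have "u * (g y - g v) < g y" using False gx by (simp add: algebra_simps)
          then show ?thesis using gv gy by (simp add: w_def pos_less_divide_eq)
        qed
        define z where "z = w *\<^sub>R v + (1 - w) *\<^sub>R y"
        have gz: "g z = 0" using gz0 by (simp add: z_def gaff)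
        have "z \<in> convex hull (set vs)"
          unfolding z_def using w u(3) hull_mono[of S "set vs" convex] hull_inc[of v "set vs" convex]
          by (intro convexD[OF convex_convex_hull]) (auto simp: set)
        then have "z \<in> convex hull {a, v, b}" using inT gz by simp
        then obtain \<alpha> \<beta> \<gamma> where z: "0 \<le> \<alpha>" "0 \<le> \<beta>" "0 \<le> \<gamma>" "\<alpha> + \<beta> + \<gamma> = 1"
          "z = \<alpha> *\<^sub>R a + \<beta> *\<^sub>R v + \<gamma> *\<^sub>R b" unfolding convex_hull_3 by auto
        have "g z = \<beta> * g v" by (simp add: g_def z(5) orient_affine3[OF z(4)])
        then have "\<beta> = 0" using gz gv by simp
        then have zS: "z \<in> convex hull S"
          using convexD[OF convex_convex_hull hull_inc[OF abS(1)] hull_inc[OF abS(2)], of \<alpha> \<gamma>] z by simp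
        have "x = (u / w) *\<^sub>R z + (1 - u / w) *\<^sub>R y"
          using \<open>u < w\<close> u(1) by (simp add: u(4) z_def algebra_simps)
        also have "\<dots> \<in> convex hull S"
          using zS u \<open>u < w\<close> by (intro convexD[OF convex_convex_hull]) auto
        finally show ?thesis by simp
      qed
    qed
  qed
  have meas: "convex hull X \<in> lmeasurable" if "finite X" for X :: "complex set"
    using that by (intro measurable_convex convex_convex_hull bounded_convex_hull finite_imp_bounded)
  have "a \<noteq> b" using o by auto
  have "convex hull S \<inter> convex hull {a, v, b} \<subseteq> {x. (\<i> * (b - a)) \<bullet> x = (\<i> * (b - a)) \<bullet> a}"
  proof
    fix x assume "x \<in> convex hull S \<inter> convex hull {a, v, b}"
    then have "0 \<le> s * orient a b x" "0 \<le> s * orient b a x" using hS hT by (auto simp: g_def)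
    then have "orient a b x = 0" using o by (auto simp: orient_swap[of b a])
    then show "x \<in> {x. (\<i> * (b - a)) \<bullet> x = (\<i> * (b - a)) \<bullet> a}" by (simp add: orient_eq_inner)
  qed
  then have "negligible (convex hull S \<inter> convex hull {a, v, b})"
    using \<open>a \<noteq> b\<close> by (intro negligible_subset[OF negligible_hyperplane]) auto
  then have "measure lebesgue (convex hull S \<inter> convex hull {a, v, b}) = 0"
    by (rule negligible_imp_measure0)
  then have "measure lebesgue (convex hull (set vs)) =
      measure lebesgue (convex hull S) + measure lebesgue (convex hull {a, v, b})"
    unfolding hull by (subst measure_Un3) (auto intro!: meas simp: S_def)
  then show ?thesis by (simp add: area_triangle_complex S_def a_def b_def v_def)
qed

section \<open>Moving one vertex\<close>

lemma eventually_edges_support_move_vertex: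
  assumes "edges_support s P" "i < length P"
  shows "\<forall>\<^sub>F t in at 0. edges_support s (P[i := P ! i + t *\<^sub>R w])"
proof -
  let ?n = "length P"
  let ?Q = "\<lambda>t. P[i := P ! i + t *\<^sub>R w]"
  have lim: "((\<lambda>t. ?Q t ! k) \<longlongrightarrow> P ! k) (at 0)" for k
    using assms(2) by (cases "k = i") (auto intro!: tendsto_eq_intros)
  define I where "I = {(j, k). j < ?n \<and> k < ?n \<and> k \<noteq> j \<and> k \<noteq> Suc j mod ?n}"
  have "finite I" by (rule finite_subset[of _ "{..<?n} \<times> {..<?n}"]) (auto simp: I_def)
  then have "\<forall>\<^sub>F t in at 0. \<forall>jk\<in>I. 0 < s * orient (?Q t ! fst jk) (?Q t ! (Suc (fst jk) mod ?n)) (?Q t ! snd jk)"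
  proof (rule eventually_ball_finite, intro ballI)
    fix jk assume "jk \<in> I"
    moreover have "((\<lambda>t. s * orient (?Q t ! fst jk) (?Q t ! (Suc (fst jk) mod ?n)) (?Q t ! snd jk)) \<longlongrightarrow>
       s * orient (P ! fst jk) (P ! (Suc (fst jk) mod ?n)) (P ! snd jk)) (at 0)"
      unfolding orient_def by (intro tendsto_intros lim)
    ultimately show "\<forall>\<^sub>F t in at 0. 0 < s * orient (?Q t ! fst jk) (?Q t ! (Suc (fst jk) mod ?n)) (?Q t ! snd jk)"
      using edges_supportD[OF assms(1)] by (intro order_tendstoD(1)) (auto simp: I_def)
  qed
  then show ?thesis
    by eventually_elim (use assms in \<open>auto simp: edges_support_def I_def\<close>)
qed

text \<open>Equality in the triangle inequality would make \<open>x + e\<close> and \<open>x - e\<close>, hence \<open>x\<close> and \<open>e\<close>, parallel.\<close>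

lemma norm_strict_midpoint_convex:
  fixes x e :: complex
  assumes "Re x * Im e \<noteq> Im x * Re e"
  shows "2 * norm x < norm (x + e) + norm (x - e)"
proof (rule ccontr)
  assume "\<not> ?thesis"
  moreover have "norm ((x + e) + (x - e)) = 2 * norm x" by (simp add: norm_mult)
  ultimately have "norm (x + e) + norm (x - e) \<le> norm ((x + e) + (x - e))" by linarith
  then have "norm ((x + e) + (x - e)) = norm (x + e) + norm (x - e)"
    using norm_triangle_ineq[of "x + e" "x - e"] by (rule antisym[rotated])
  then have eq: "norm (x + e) *\<^sub>R (x - e) = norm (x - e) *\<^sub>R (x + e)"
    using norm_triangle_eq by blast
  define \<alpha> \<beta> where "\<alpha> = norm (x + e)" and "\<beta> = norm (x - e)"
  have "\<alpha> * (Re x - Re e) = \<beta> * (Re x + Re e)" "\<alpha> * (Im x - Im e) = \<beta> * (Im x + Im e)"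
    using arg_cong[OF eq, of Re] arg_cong[OF eq, of Im] by (simp_all add: \<alpha>_def \<beta>_def)
  then have "(\<alpha> + \<beta>) * (Re x * Im e - Im x * Re e) = 0" by algebra
  then have "\<alpha> + \<beta> = 0" using assms by simp
  then have "\<alpha> = 0" unfolding \<alpha>_def \<beta>_def using norm_ge_zero[of "x + e"] norm_ge_zero[of "x - e"] by linarith
  then have "e = - x" by (simp add: \<alpha>_def eq_neg_iff_add_eq_0 add.commute)
  then show False using assms by simp
qed

text \<open>Each side length is a convex function of the displacement of the vertex, and it is strictly convex for a
  side that ends at the vertex and is not parallel to the displacement. The condition on \<open>w\<close> says this
  for the side that leaves the vertex.\<close>

lemma perimeter_strict_midpoint_convex:
  assumes n: "length P \<ge> 2" and i: "i < length P"
    and w: "orient (P ! (Suc i mod length P)) (P ! i) (P ! (Suc i mod length P) + w) \<noteq> 0" and t: "t \<noteq> 0"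
  shows "2 * perimeter P < perimeter (P[i := P ! i + t *\<^sub>R w]) + perimeter (P[i := P ! i + (- t) *\<^sub>R w])"
proof -
  let ?n = "length P"
  let ?Q = "\<lambda>t. P[i := P ! i + t *\<^sub>R w]"
  define e where "e k = (if k = i then t *\<^sub>R w else 0)" for k
  have Q: "?Q t ! k = P ! k + e k" "?Q (- t) ! k = P ! k - e k" if "k < ?n" for k
    using that i by (auto simp: e_def)
  have m: "Suc k mod ?n < ?n" for k using i by (intro mod_less_divisor) linarith
  have dist: "dist (?Q t ! k) (?Q t ! (Suc k mod ?n)) + dist (?Q (- t) ! k) (?Q (- t) ! (Suc k mod ?n)) =
     norm ((P ! k - P ! (Suc k mod ?n)) + (e k - e (Suc k mod ?n))) +
     norm ((P ! k - P ! (Suc k mod ?n)) - (e k - e (Suc k mod ?n)))" if "k < ?n" for k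
    unfolding Q[OF that] Q[OF m] dist_norm by (simp add: algebra_simps)
  have "(\<Sum>k<?n. 2 * dist (P ! k) (P ! (Suc k mod ?n))) <
    (\<Sum>k<?n. dist (?Q t ! k) (?Q t ! (Suc k mod ?n)) + dist (?Q (- t) ! k) (?Q (- t) ! (Suc k mod ?n)))"
  proof (rule sum_strict_mono_ex1)
    show "\<forall>k\<in>{..<?n}. 2 * dist (P ! k) (P ! (Suc k mod ?n)) \<le>
      dist (?Q t ! k) (?Q t ! (Suc k mod ?n)) + dist (?Q (- t) ! k) (?Q (- t) ! (Suc k mod ?n))"
    proof
      fix k assume "k \<in> {..<?n}"
      then have k: "k < ?n" by simp
      have "norm (2 * x) \<le> norm (x + d) + norm (x - d)" for x d :: complex
        using norm_triangle_ineq[of "x + d" "x - d"] by simp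
      then have "2 * norm x \<le> norm (x + d) + norm (x - d)" for x d :: complex
        by (simp add: norm_mult)
      from this[of "P ! k - P ! (Suc k mod ?n)" "e k - e (Suc k mod ?n)"]
      show "2 * dist (P ! k) (P ! (Suc k mod ?n)) \<le>
        dist (?Q t ! k) (?Q t ! (Suc k mod ?n)) + dist (?Q (- t) ! k) (?Q (- t) ! (Suc k mod ?n))"
        unfolding dist[OF k] by (simp add: dist_norm)
    qed
    have "Suc i mod ?n \<noteq> i" using n by (cases rule: Suc_mod_cases[OF i]) auto
    then have e: "e i - e (Suc i mod ?n) = t *\<^sub>R w" by (simp add: e_def)
    let ?x = "P ! i - P ! (Suc i mod ?n)"
    have "t * (Re ?x * Im w - Im ?x * Re w) \<noteq> 0" using w t by (simp add: orient_def)
    then have "Re ?x * Im (t *\<^sub>R w) \<noteq> Im ?x * Re (t *\<^sub>R w)" by (simp add: algebra_simps)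
    from norm_strict_midpoint_convex[OF this]
    have "2 * dist (P ! i) (P ! (Suc i mod ?n)) <
      dist (?Q t ! i) (?Q t ! (Suc i mod ?n)) + dist (?Q (- t) ! i) (?Q (- t) ! (Suc i mod ?n))"
      unfolding dist[OF i] e by (simp add: dist_norm)
    then show "\<exists>k\<in>{..<?n}. 2 * dist (P ! k) (P ! (Suc k mod ?n)) <
      dist (?Q t ! k) (?Q t ! (Suc k mod ?n)) + dist (?Q (- t) ! k) (?Q (- t) ! (Suc k mod ?n))"
      using i by blast
  qed simp
  then show ?thesis by (simp add: perimeter_def sum.distrib sum_distrib_left)
qed

section \<open>Maximizers of the perimeter\<close>

theorem theorem1:
  fixes A :: real and n :: nat and P :: "complex list"
  assumes "0 < A" and "A < pi" and "n \<ge> 3"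
    and "is_arg_max perimeter (\<lambda>Q. Q \<in> polygon_class n A) P"
    and "no_redundant_vertices P"
  shows "inscribed P"
proof (rule ccontr)
  let ?n = "length P"
  have PC: "P \<in> polygon_class n A" and max: "\<And>Q. Q \<in> polygon_class n A \<Longrightarrow> perimeter Q \<le> perimeter P"
    using assms(4) by (auto simp: is_arg_max_def not_less)
  then have sc: "simple_convex_polygon P" and disk: "polygon_region P \<subseteq> cball 0 1"
    and len: "?n \<le> n" and area: "area P \<le> A" by (auto simp: polygon_class_def)
  obtain s where E: "edges_support s P"
    using simple_convex_polygon_imp_edges_support[OF sc assms(5)] by blast
  have n: "?n \<ge> 3" using E by (simp add: edges_support_def)
  have region: "polygon_region P = convex hull (set P)" by (rule edges_support_imp_region_eq_hull[OF E])
  then have disk': "set P \<subseteq> cball 0 1" using disk hull_subset[of "set P" convex] by auto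
  assume "\<not> inscribed P"
  then obtain i where i: "i < ?n" and free: "P ! i \<notin> frontier (cball 0 1)"
    by (auto simp: inscribed_def in_set_conv_nth)
  have inside_disk: "norm (P ! i) < 1"
  proof -
    have "P ! i \<in> cball 0 1" "P ! i \<notin> sphere 0 1" using free disk' nth_mem[OF i] by auto
    then show ?thesis by simp
  qed
  define p where "p = (if i = 0 then ?n - 1 else i - 1)"
  define q where "q = Suc i mod ?n"
  have p: "p < ?n" "Suc p mod ?n = i" using i n by (auto simp: p_def)
  have q: "q < ?n" unfolding q_def using i by (intro mod_less_divisor) linarith
  note pq = cyclic_neighbours(3-5)[OF n p q_def]
  \<comment> \<open>Moving parallel to the chord keeps the height of the triangle, hence the area.\<close>
  define w where "w = P ! q - P ! p"
  define Q where "Q t = P[i := P ! i + t *\<^sub>R w]" for t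
  have "((\<lambda>t. norm (P ! i + t *\<^sub>R w)) \<longlongrightarrow> norm (P ! i)) (at 0)"
    by (auto intro!: tendsto_eq_intros)
  then have "\<forall>\<^sub>F t in at 0. norm (P ! i + t *\<^sub>R w) < 1"
    using inside_disk by (rule order_tendstoD)
  then have "\<forall>\<^sub>F t in at 0. edges_support s (Q t) \<and> norm (P ! i + t *\<^sub>R w) < 1"
    using eventually_edges_support_move_vertex[OF E i, of w] unfolding Q_def by (rule eventually_conj[rotated])
  then obtain r where r: "0 < r"
    "\<And>t. t \<noteq> 0 \<Longrightarrow> \<bar>t\<bar> < r \<Longrightarrow> edges_support s (Q t) \<and> norm (P ! i + t *\<^sub>R w) < 1"
    by (auto simp: eventually_at dist_real_def)
  have adm: "Q t \<in> polygon_class n A" if t: "t \<noteq> 0" "\<bar>t\<bar> < r" for t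
  proof -
    have EQ: "edges_support s (Q t)" using r(2)[OF t] by blast
    have lQ: "length (Q t) = ?n" by (simp add: Q_def)
    have hull: "polygon_region (Q t) = convex hull (set (Q t))"
      by (rule edges_support_imp_region_eq_hull[OF EQ])
    have "set (Q t) \<subseteq> cball 0 1"
      using disk' r(2)[OF t] set_update_subset_insert[of P i "P ! i + t *\<^sub>R w"] by (force simp: Q_def)
    then have "polygon_region (Q t) \<subseteq> cball 0 1" unfolding hull by (intro hull_minimal) auto
    moreover have "area (Q t) = area P"
    proof -
      have "(!) (Q t) ` ({..<?n} - {i}) = (!) P ` ({..<?n} - {i})"
        by (intro image_cong) (auto simp: Q_def)
      moreover have "orient (Q t ! p) (Q t ! i) (Q t ! q) = orient (P ! p) (P ! i) (P ! q)"
        using pq i by (simp add: Q_def w_def orient_def algebra_simps)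
      ultimately show ?thesis
        unfolding area_def hull region
        using measure_hull_cut_vertex[OF E p q_def] measure_hull_cut_vertex[OF EQ, of p i q] p q_def
        by (simp add: lQ)
    qed
    ultimately show ?thesis
      using edges_support_imp_simple_path[OF EQ] n len area
      by (simp add: polygon_class_def simple_convex_polygon_def lQ hull)
  qed
  have "0 < s * orient (P ! p) (P ! i) (P ! q)"
    using edges_supportD[OF E p(1) q] pq p(2) by simp
  moreover have "orient (P ! q) (P ! i) (P ! q + w) = orient (P ! p) (P ! i) (P ! q)"
    by (simp add: w_def orient_def algebra_simps)
  ultimately have "orient (P ! q) (P ! i) (P ! q + w) \<noteq> 0" by auto
  then have "2 * perimeter P < perimeter (Q (r / 2)) + perimeter (Q (- (r / 2)))"
    unfolding Q_def using perimeter_strict_midpoint_convex[of P i w "r / 2"] n i r(1) by (simp add: q_def)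
  moreover have "perimeter (Q (r / 2)) \<le> perimeter P" "perimeter (Q (- (r / 2))) \<le> perimeter P"
    using r(1) by (auto intro!: max adm)
  ultimately show False by linarith
qed

end
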